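(* Let $r\ge 0$ and $d\ge 1$ be integers. The limit as $n\to\infty$ of the probability that the $r$th leaf in a random binary tree of size $n$ has depth $d$ exists. Denoting this limit by $p_{r,d}$, we have $$\sum_{r\ge0}\sum_{d\ge1} p_{r,d}\, x^r y^d = \frac{y}{(2-2y+y\sqrt{1-x})^2}.$$
   Context: A binary tree here means a complete binary tree: a rooted tree where each internal (non-leaf) node has a left child and a right child (the single-node tree is allowed). Its size is its number of internal nodes; a binary tree of size $n$ has $n+1$ leaves, and the number of binary trees of size $n$ is the Catalan number $c_n=\frac{1}{n+1}\binom{2n}{n}$. The $n+1$ leaves are indexed $0,1,\dots,n$ from left to right: leaf $\ell_1$ precedes leaf $\ell_2$ if, at the first node where the paths from the root to these leaves differ, the path to $\ell_1$ goes left and the path to $\ell_2$ goes right. The depth of a leaf is the number of edges in the path from the root to it. A random binary tree of size $n$ is chosen uniformly among all $c_n$ of them (with $n\ge r$, so that the $r$th leaf exists). The identity is one of formal power series in $x,y$. *)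

theory Defs
  imports
    "HOL-Library.Tree"
    "HOL-Computational_Algebra.Formal_Power_Series"
    "HOL-Probability.Probability_Mass_Function"
begin

text \<open>
  Binary trees (every internal node has a left and a right child) are the values of type
  \<^typ>\<open>unit tree\<close>: the internal nodes are the \<^const>\<open>Node\<close>s, whose labels carry no information,
  and \<^term>\<open>size t\<close> counts exactly these internal nodes.

  A leaf is identified with the path leading to it from the root, so its depth is the length
  of that path.
\<close>

datatype dir = GoLeft | GoRight

fun leaf_paths :: "'a tree \<Rightarrow> dir list set" where
  "leaf_paths Leaf = {[]}"
| "leaf_paths (Node l a r) = (#) GoLeft ` leaf_paths l \<union> (#) GoRight ` leaf_paths r"

text \<open>The list \<open>u\<close> is the path to the first node at which the two paths part.\<close>

definition precedes :: "dir list \<Rightarrow> dir list \<Rightarrow> bool" where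
  "precedes p q \<longleftrightarrow> (\<exists>u v w. p = u @ GoLeft # v \<and> q = u @ GoRight # w)"

definition leaf_index :: "'a tree \<Rightarrow> dir list \<Rightarrow> nat" where
  "leaf_index t p = card {q \<in> leaf_paths t. precedes q p}"

definition nth_leaf_has_depth :: "'a tree \<Rightarrow> nat \<Rightarrow> nat \<Rightarrow> bool" where
  "nth_leaf_has_depth t r d \<longleftrightarrow> (\<exists>p \<in> leaf_paths t. leaf_index t p = r \<and> length p = d)"

definition random_tree :: "nat \<Rightarrow> unit tree pmf" where
  "random_tree n = pmf_of_set {t. size t = n}"

text \<open>For \<open>n < r\<close> there is no such leaf and the value is 0; this does not affect the limit.\<close>

definition depth_prob :: "nat \<Rightarrow> nat \<Rightarrow> nat \<Rightarrow> real" where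
  "depth_prob r d n = measure_pmf.prob (random_tree n) {t. nth_leaf_has_depth t r d}"

text \<open>
  Bivariate formal power series in \<open>x\<close> and \<open>y\<close> are represented as power series in \<open>y\<close>
  whose coefficients are power series in \<open>x\<close>.
\<close>

definition fps_x :: "real fps fps" where
  "fps_x = fps_const fps_X"

definition fps_y :: "real fps fps" where
  "fps_y = fps_X"

text \<open>The square root of \<open>1 - x\<close> with constant coefficient 1.\<close>

definition sqrt_one_minus_x :: "real fps fps" where
  "sqrt_one_minus_x = fps_const (fps_radical root 2 (1 - fps_X))"

text \<open>\<open>c i j\<close> is the coefficient of \<open>x ^ i * y ^ j\<close>.\<close>

definition bivariate_fps :: "(nat \<Rightarrow> nat \<Rightarrow> real) \<Rightarrow> real fps fps" where
  "bivariate_fps c = Abs_fps (\<lambda>j. Abs_fps (\<lambda>i. c i j))"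

lemma sqrt_one_minus_x_power2: "sqrt_one_minus_x ^ 2 = 1 - fps_x"
proof -
  have "fps_radical root 2 (1 - fps_X :: real fps) ^ 2 = 1 - fps_X"
    using power_radical[of "1 - fps_X :: real fps" root 1] by (simp add: numeral_2_eq_2)
  then show ?thesis
    by (simp add: sqrt_one_minus_x_def fps_x_def fps_const_power flip: fps_const_sub)
qed

lemma sqrt_one_minus_x_nth_0: "fps_nth (fps_nth sqrt_one_minus_x 0) 0 = 1"
  by (simp add: sqrt_one_minus_x_def)

lemma finite_trees_of_size: "finite {t :: unit tree. size t = n}"
proof (induction n rule: less_induct)
  case (less n)
  let ?S = "\<Union>i<n. {t :: unit tree. size t = i}"
  have "{t :: unit tree. size t = n} \<subseteq> insert Leaf ((\<lambda>(l, r). Node l () r) ` (?S \<times> ?S))"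
  proof
    fix t :: "unit tree" assume "t \<in> {t. size t = n}"
    then show "t \<in> insert Leaf ((\<lambda>(l, r). Node l () r) ` (?S \<times> ?S))"
      by (cases t) (auto simp: image_iff)
  qed
  moreover have "finite ?S" using less by blast
  ultimately show ?case by (meson finite_SigmaI finite_imageI finite_insert finite_subset)
qed

lemma trees_of_size_nonempty: "{t :: unit tree. size t = n} \<noteq> {}"
proof (induction n)
  case (Suc n)
  then obtain t :: "unit tree" where "size t = n" by blast
  then have "size (Node t () Leaf) = Suc n" by simp
  then show ?case by blast
qed auto

lemma card_leaf_paths: "finite (leaf_paths t) \<and> card (leaf_paths t) = size t + 1"
proof (induction t)
  case (Node l a r)
  then show ?case
    by (subst leaf_paths.simps, subst card_Un_disjoint) (auto simp: card_image)
qed auto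

end

theory Submission
  imports Defs
begin

text \<open>
  A tree with a marked leaf of depth \<open>d\<close> is a path of \<open>d\<close> steps with one tree hanging off each
  node on it: to the right at a step to the left, to the left at a step to the right. The index
  of the marked leaf is the number of leaves of the trees hanging to the left. Let \<open>x\<close> mark the
  index and \<open>z\<close> the size, and let \<open>C\<close> be the generating function of all trees; then a step
  contributes the factor \<open>z (C(z) + x C(x z))\<close>, and the trees whose leaf \<open>r\<close> has depth \<open>d\<close>
  are counted by the coefficients of \<open>z ^ d (C(z) + x C(x z)) ^ d\<close>
  (\<open>trees_with_leaf_fps_eq_power\<close>). For fixed \<open>r\<close>, the binomial theorem makes the coefficient of
  \<open>x ^ r\<close> a finite combination of the series \<open>z ^ m C ^ k\<close> (\<open>trees_with_leaf_fps_expand\<close>), so it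
  remains to compare the coefficients of these series with the number \<open>c\<^sub>n\<close> of trees of size \<open>n\<close>.

  For that, say that \<open>f\<close> has density \<open>L\<close> if \<open>f\<^sub>n / c\<^sub>n\<close> tends to \<open>L\<close>. Density is linear, and
  multiplication by \<open>z\<close> divides it by \<open>4\<close> because \<open>c\<^sub>n\<^sub>+\<^sub>1 / c\<^sub>n\<close> tends to \<open>4\<close>. The equation
  \<open>z C ^ (k + 2) = C ^ (k + 1) - C ^ k\<close> therefore determines the density of \<open>C ^ k\<close> by a linear
  recurrence, with the result \<open>k 2 ^ (k - 1)\<close>.

  Every factor \<open>z\<close> contributes \<open>1/4\<close>, which turns the part \<open>x z C(x z)\<close> coming from the trees on
  the left into \<open>W = (x/4) C(x/4) = (1 - sqrt (1 - x)) / 2\<close>. Summing the binomial expansion with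
  the densities gives \<open>\<Sum>\<^sub>r p\<^sub>r\<^sub>,\<^sub>d x ^ r = (d/4) (1/2 + W) ^ (d - 1)\<close>, and the sum over \<open>d\<close> is the
  derivative of a geometric series.
\<close>

section \<open>Counting trees\<close>

text \<open>Splitting a nonempty tree at its root, according to the size of the left subtree.\<close>

lemma card_trees_Suc:
  fixes P :: "unit tree \<Rightarrow> bool"
  shows "card {t. size t = Suc n \<and> P t} =
    (\<Sum>i\<le>n. card {(l, t). size l = i \<and> size t = n - i \<and> P (Node l () t)})"
proof -
  let ?S = "\<lambda>i. {(l, t). size l = i \<and> size t = n - i \<and> P (Node l () t)}"
  let ?f = "\<lambda>(l, t). Node l () t"
  have fin: "finite (?S i)" for i
  proof (rule finite_subset)
    show "?S i \<subseteq> {l. size l = i} \<times> {t. size t = n - i}" by auto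
    show "finite ({l :: unit tree. size l = i} \<times> {t :: unit tree. size t = n - i})"
      by (simp add: finite_trees_of_size)
  qed
  have "{t. size t = Suc n \<and> P t} = ?f ` (\<Union>i\<le>n. ?S i)"
  proof (intro set_eqI iffI)
    fix t assume t: "t \<in> {t. size t = Suc n \<and> P t}"
    then obtain l u where "t = Node l () u" by (cases t) auto
    with t have "t = ?f (l, u)" "(l, u) \<in> (\<Union>i\<le>n. ?S i)" by auto
    then show "t \<in> ?f ` (\<Union>i\<le>n. ?S i)" by (rule image_eqI)
  qed auto
  moreover have "inj_on ?f (\<Union>i\<le>n. ?S i)" by (auto simp: inj_on_def)
  ultimately have "card {t. size t = Suc n \<and> P t} = card (\<Union>i\<le>n. ?S i)"
    by (simp add: card_image)
  also have "\<dots> = (\<Sum>i\<le>n. card (?S i))"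
    by (rule card_UN_disjoint) (use fin in auto)
  finally show ?thesis .
qed

definition num_trees :: "nat \<Rightarrow> nat" where
  "num_trees n = card {t :: unit tree. size t = n}"

definition num_trees_with_leaf :: "nat \<Rightarrow> nat \<Rightarrow> nat \<Rightarrow> nat" where
  "num_trees_with_leaf r d n = card {t :: unit tree. size t = n \<and> nth_leaf_has_depth t r d}"

lemma num_trees_pos: "num_trees n > 0"
  using trees_of_size_nonempty[of n] finite_trees_of_size[of n]
  by (auto simp: num_trees_def card_gt_0_iff)

lemma num_trees_nonzero [simp]: "num_trees n \<noteq> 0"
  using num_trees_pos[of n] by simp

lemma num_trees_0: "num_trees 0 = 1"
proof -
  have "{t :: unit tree. size t = 0} = {Leaf}" by auto
  then show ?thesis by (simp add: num_trees_def)
qed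

lemma num_trees_Suc: "num_trees (Suc n) = (\<Sum>i\<le>n. num_trees i * num_trees (n - i))"
proof -
  have "{(l :: unit tree, t :: unit tree). size l = i \<and> size t = n - i} =
      {l. size l = i} \<times> {t. size t = n - i}" for i by auto
  then show ?thesis
    using card_trees_Suc[of n "\<lambda>_. True"] by (simp add: num_trees_def card_cartesian_product)
qed

lemma depth_prob_eq: "depth_prob r d n = real (num_trees_with_leaf r d n) / real (num_trees n)"
proof -
  have "{t :: unit tree. size t = n} \<inter> {t. nth_leaf_has_depth t r d} =
      {t. size t = n \<and> nth_leaf_has_depth t r d}" by auto
  then show ?thesis
    unfolding depth_prob_def random_tree_def num_trees_with_leaf_def num_trees_def
    by (simp add: measure_pmf_of_set[OF trees_of_size_nonempty finite_trees_of_size])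
qed

section \<open>Locating a leaf in the subtrees\<close>

lemma precedes_simps [simp]:
  "\<not> precedes p []"
  "precedes (GoLeft # p) (GoLeft # q) \<longleftrightarrow> precedes p q"
  "precedes (GoRight # p) (GoRight # q) \<longleftrightarrow> precedes p q"
  "precedes (GoLeft # p) (GoRight # q)"
  "\<not> precedes (GoRight # p) (GoLeft # q)"
  by (auto simp: precedes_def Cons_eq_append_conv)

lemma precedes_irrefl [simp]: "\<not> precedes p p"
  by (auto simp: precedes_def)

lemma leaf_index_le_size:
  assumes "p \<in> leaf_paths t"
  shows "leaf_index t p \<le> size t"
proof -
  have "leaf_index t p \<le> card (leaf_paths t - {p})"
    unfolding leaf_index_def by (rule card_mono) (auto simp: card_leaf_paths)
  then show ?thesis using assms card_leaf_paths[of t] by simp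
qed

lemma leaf_index_GoLeft: "leaf_index (Node l a t) (GoLeft # p) = leaf_index l p"
proof -
  have "{q \<in> leaf_paths (Node l a t). precedes q (GoLeft # p)} =
      (#) GoLeft ` {q \<in> leaf_paths l. precedes q p}"
    by auto
  then show ?thesis by (simp add: leaf_index_def card_image)
qed

lemma leaf_index_GoRight:
  "leaf_index (Node l a t) (GoRight # p) = size l + 1 + leaf_index t p"
proof -
  have "{q \<in> leaf_paths (Node l a t). precedes q (GoRight # p)} =
      (#) GoLeft ` leaf_paths l \<union> (#) GoRight ` {q \<in> leaf_paths t. precedes q p}"
    by auto
  moreover have "card \<dots> = card (leaf_paths l) + card {q \<in> leaf_paths t. precedes q p}"
    by (subst card_Un_disjoint) (auto simp: card_image card_leaf_paths)
  ultimately show ?thesis by (simp add: leaf_index_def card_leaf_paths)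
qed

lemma nth_leaf_has_depth_Leaf: "nth_leaf_has_depth Leaf r d \<longleftrightarrow> r = 0 \<and> d = 0"
  by (auto simp: nth_leaf_has_depth_def leaf_index_def)

lemma nth_leaf_has_depth_Node_0: "\<not> nth_leaf_has_depth (Node l a t) r 0"
  by (auto simp: nth_leaf_has_depth_def)

lemma nth_leaf_has_depth_Node_Suc:
  "nth_leaf_has_depth (Node l a t) r (Suc d) \<longleftrightarrow>
    nth_leaf_has_depth l r d \<or> size l < r \<and> nth_leaf_has_depth t (r - Suc (size l)) d"
proof -
  have "nth_leaf_has_depth (Node l a t) r (Suc d) \<longleftrightarrow>
      (\<exists>p \<in> leaf_paths l. leaf_index l p = r \<and> length p = d) \<or>
      (\<exists>p \<in> leaf_paths t. size l + 1 + leaf_index t p = r \<and> length p = d)"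
    by (simp add: nth_leaf_has_depth_def bex_Un leaf_index_GoLeft leaf_index_GoRight
        del: add_Suc)
  also have "(\<exists>p \<in> leaf_paths t. size l + 1 + leaf_index t p = r \<and> length p = d) \<longleftrightarrow>
      size l < r \<and> nth_leaf_has_depth t (r - Suc (size l)) d"
  proof -
    have "size l + 1 + m = r \<longleftrightarrow> size l < r \<and> m = r - Suc (size l)" for m by auto
    then show ?thesis by (auto simp: nth_leaf_has_depth_def)
  qed
  finally show ?thesis by (simp add: nth_leaf_has_depth_def)
qed

lemma nth_leaf_has_depth_le_size: "nth_leaf_has_depth t r d \<Longrightarrow> r \<le> size t"
  by (auto simp: nth_leaf_has_depth_def leaf_index_le_size)

lemma num_trees_with_leaf_depth_0:
  "num_trees_with_leaf r 0 n = (if r = 0 \<and> n = 0 then 1 else 0)"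
proof -
  have "{t :: unit tree. size t = n \<and> nth_leaf_has_depth t r 0} =
      (if r = 0 \<and> n = 0 then {Leaf} else {})"
  proof (intro set_eqI)
    fix t :: "unit tree"
    show "t \<in> {t. size t = n \<and> nth_leaf_has_depth t r 0} \<longleftrightarrow>
        t \<in> (if r = 0 \<and> n = 0 then {Leaf} else {})"
      by (cases t) (auto simp: nth_leaf_has_depth_Leaf nth_leaf_has_depth_Node_0)
  qed
  then show ?thesis by (simp add: num_trees_with_leaf_def)
qed

lemma num_trees_with_leaf_size_0: "num_trees_with_leaf r (Suc d) 0 = 0"
proof -
  have "{t :: unit tree. size t = 0 \<and> nth_leaf_has_depth t r (Suc d)} = {}"
    by (auto simp: nth_leaf_has_depth_Leaf)
  then show ?thesis by (simp add: num_trees_with_leaf_def)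
qed

text \<open>
  The two alternatives, leaf \<open>r\<close> in the left or in the right subtree, exclude each other because
  the left subtree has only the leaves \<open>0, \<dots>, i\<close>.
\<close>

lemma num_trees_with_leaf_Suc:
  "num_trees_with_leaf r (Suc d) (Suc n) =
    (\<Sum>i\<le>n. num_trees_with_leaf r d i * num_trees (n - i)) +
    (\<Sum>i\<le>n. if i < r then num_trees i * num_trees_with_leaf (r - Suc i) d (n - i) else 0)"
proof -
  have "card {(l :: unit tree, t :: unit tree). size l = i \<and> size t = n - i \<and>
          nth_leaf_has_depth (Node l () t) r (Suc d)} =
      num_trees_with_leaf r d i * num_trees (n - i) +
      (if i < r then num_trees i * num_trees_with_leaf (r - Suc i) d (n - i) else 0)" for i
  proof -
    let ?A = "{l :: unit tree. size l = i \<and> nth_leaf_has_depth l r d} \<times>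
        {t :: unit tree. size t = n - i}"
    let ?B = "if i < r then {l :: unit tree. size l = i} \<times>
        {t :: unit tree. size t = n - i \<and> nth_leaf_has_depth t (r - Suc i) d} else {}"
    have "{(l :: unit tree, t :: unit tree). size l = i \<and> size t = n - i \<and>
        nth_leaf_has_depth (Node l () t) r (Suc d)} = ?A \<union> ?B"
      by (auto simp: nth_leaf_has_depth_Node_Suc)
    moreover have "card (?A \<union> ?B) = card ?A + card ?B"
    proof (rule card_Un_disjoint)
      show "?A \<inter> ?B = {}" by (auto dest: nth_leaf_has_depth_le_size)
    qed (auto simp: finite_trees_of_size intro!: finite_cartesian_product)
    moreover have "card ?A = num_trees_with_leaf r d i * num_trees (n - i)"
      by (simp add: card_cartesian_product num_trees_def num_trees_with_leaf_def)
    moreover have "card ?B =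
        (if i < r then num_trees i * num_trees_with_leaf (r - Suc i) d (n - i) else 0)"
      by (simp add: card_cartesian_product num_trees_def num_trees_with_leaf_def)
    ultimately show ?thesis by simp
  qed
  then show ?thesis
    unfolding num_trees_with_leaf_def[of r "Suc d"] card_trees_Suc by (simp add: sum.distrib)
qed

section \<open>The Catalan generating function\<close>

definition catalan_fps :: "real fps" where
  "catalan_fps = Abs_fps (\<lambda>n. real (num_trees n))"

lemma catalan_fps_nth [simp]: "fps_nth catalan_fps n = real (num_trees n)"
  by (simp add: catalan_fps_def)

lemma catalan_fps_quadratic: "catalan_fps = 1 + fps_X * catalan_fps ^ 2"
proof (rule fps_ext)
  fix n
  show "fps_nth catalan_fps n = fps_nth (1 + fps_X * catalan_fps ^ 2) n"
    by (cases n)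
      (simp_all add: num_trees_0 num_trees_Suc power2_eq_square fps_mult_nth[of catalan_fps]
        atLeast0AtMost)
qed

lemma catalan_fps_power_Suc_Suc:
  "fps_X * catalan_fps ^ Suc (Suc k) = catalan_fps ^ Suc k - catalan_fps ^ k"
proof -
  have "fps_X * catalan_fps ^ Suc (Suc k) = catalan_fps ^ k * (fps_X * catalan_fps ^ 2)"
    by (simp add: power2_eq_square algebra_simps)
  also have "fps_X * catalan_fps ^ 2 = catalan_fps - 1"
    using catalan_fps_quadratic by (simp add: algebra_simps)
  finally show ?thesis by (simp add: algebra_simps)
qed

text \<open>
  \<open>R = 1 - 2 x C\<close> is a square root of \<open>1 - 4 x\<close>, so it satisfies the differential equation
  \<open>(1 - 4 x) R' = -2 R\<close>; reading off coefficients gives the recurrence.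
\<close>

lemma num_trees_ratio: "(real n + 2) * real (num_trees (Suc n)) = (4 * real n + 2) * real (num_trees n)"
proof -
  define R where "R = 1 - 2 * fps_X * catalan_fps"
  have R2: "R ^ 2 = 1 - 4 * fps_X"
  proof -
    have "R ^ 2 = 1 - 4 * fps_X * (catalan_fps - fps_X * catalan_fps ^ 2)"
      by (simp add: R_def power2_eq_square algebra_simps)
    also have "catalan_fps - fps_X * catalan_fps ^ 2 = 1"
      using catalan_fps_quadratic by (simp add: algebra_simps)
    finally show ?thesis by simp
  qed
  have "fps_deriv (R ^ 2) = - 4"
    unfolding R2 by simp
  then have "2 * (R * fps_deriv R) = 2 * (- 2)"
    by (simp add: power2_eq_square algebra_simps)
  then have RR: "R * fps_deriv R = - 2"
    unfolding mult_cancel_left by simp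
  have "(1 - 4 * fps_X) * fps_deriv R = R * (R * fps_deriv R)"
    by (simp add: R2[symmetric] power2_eq_square mult.assoc)
  also have "\<dots> = - 2 * R" by (simp add: RR)
  finally have "fps_nth ((1 - 4 * fps_X) * fps_deriv R) (Suc n) = fps_nth (- 2 * R) (Suc n)"
    by simp
  moreover have "fps_nth R (Suc m) = - 2 * real (num_trees m)" for m
    by (simp add: R_def mult.assoc numeral_fps_const)
  ultimately show ?thesis
    by (simp add: left_diff_distrib mult.assoc numeral_fps_const algebra_simps)
qed

lemma num_trees_ratio_tendsto:
  "(\<lambda>n. real (num_trees (Suc n)) / real (num_trees n)) \<longlonglongrightarrow> 4"
proof -
  have "real (num_trees (Suc n)) / real (num_trees n) = 4 - 6 * inverse (real (Suc (Suc n)))" for n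
  proof -
    have "real (num_trees (Suc n)) / real (num_trees n) = (4 * real n + 2) / (real n + 2)"
      using num_trees_ratio[of n] by (simp add: field_simps)
    also have "\<dots> = 4 - 6 * inverse (real (Suc (Suc n)))"
      by (simp add: field_simps)
    finally show ?thesis .
  qed
  moreover have "(\<lambda>n. 4 - 6 * inverse (real (Suc (Suc n)))) \<longlonglongrightarrow> 4 - 6 * 0"
    by (intro tendsto_intros LIMSEQ_Suc[OF LIMSEQ_inverse_real_of_nat])
  ultimately show ?thesis by simp
qed

section \<open>Densities relative to the Catalan numbers\<close>

definition has_density :: "real fps \<Rightarrow> real \<Rightarrow> bool" where
  "has_density f L \<longleftrightarrow> (\<lambda>n. fps_nth f n / real (num_trees n)) \<longlonglongrightarrow> L"

lemma has_density_diff: "has_density f L \<Longrightarrow> has_density g M \<Longrightarrow> has_density (f - g) (L - M)"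
  unfolding has_density_def by (drule (1) tendsto_diff) (simp add: diff_divide_distrib)

lemma has_density_cmult: "has_density f L \<Longrightarrow> has_density (fps_const c * f) (c * L)"
  unfolding has_density_def by (drule tendsto_mult_left[of _ _ _ c]) simp

lemma has_density_sum:
  assumes "\<And>i. i \<in> I \<Longrightarrow> has_density (f i) (L i)"
  shows "has_density (\<Sum>i\<in>I. f i) (\<Sum>i\<in>I. L i)"
proof -
  have "(\<lambda>n. \<Sum>i\<in>I. fps_nth (f i) n / real (num_trees n)) \<longlonglongrightarrow> (\<Sum>i\<in>I. L i)"
    using assms unfolding has_density_def by (intro tendsto_sum)
  then show ?thesis by (simp add: has_density_def fps_sum_nth sum_divide_distrib)
qed

text \<open>
  Multiplication by \<open>x\<close> shifts the coefficients, and a shift costs a factor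
  \<open>num_trees (Suc n) / num_trees n\<close>. The converse direction lets a factor \<open>x\<close> be cancelled.
\<close>

lemma has_density_X_mult_iff: "has_density (fps_X * f) (L / 4) \<longleftrightarrow> has_density f L"
proof -
  let ?q = "\<lambda>n. real (num_trees (Suc n)) / real (num_trees n)"
  let ?a = "\<lambda>n. fps_nth f n / real (num_trees n)"
  let ?b = "\<lambda>n. fps_nth f n / real (num_trees (Suc n))"
  have "has_density (fps_X * f) (L / 4) \<longleftrightarrow> ?b \<longlonglongrightarrow> L / 4"
    unfolding has_density_def by (subst filterlim_sequentially_Suc[symmetric]) simp
  also have "\<dots> \<longleftrightarrow> ?a \<longlonglongrightarrow> L"
  proof
    assume "?b \<longlonglongrightarrow> L / 4"
    then have "(\<lambda>n. ?b n * ?q n) \<longlonglongrightarrow> L / 4 * 4"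
      by (intro tendsto_mult num_trees_ratio_tendsto)
    then show "?a \<longlonglongrightarrow> L" by simp
  next
    assume "?a \<longlonglongrightarrow> L"
    then have "(\<lambda>n. ?a n / ?q n) \<longlonglongrightarrow> L / 4"
      by (intro tendsto_divide num_trees_ratio_tendsto) auto
    then show "?b \<longlonglongrightarrow> L / 4" by simp
  qed
  finally show ?thesis by (simp add: has_density_def)
qed

lemma has_density_X_power_mult: "has_density f L \<Longrightarrow> has_density (fps_X ^ m * f) (L / 4 ^ m)"
proof (induction m)
  case (Suc m)
  then have "has_density (fps_X * (fps_X ^ m * f)) (L / 4 ^ m / 4)"
    by (simp only: has_density_X_mult_iff)
  then show ?case by (simp add: mult_ac)
qed simp

text \<open>
  The value \<open>k * 2 ^ k / 2\<close> is \<open>k * 2 ^ (k - 1)\<close> written without a truncated subtraction. It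
  solves the recurrence \<open>a\<^sub>k\<^sub>+\<^sub>2 = 4 (a\<^sub>k\<^sub>+\<^sub>1 - a\<^sub>k)\<close> that comes from \<open>catalan_fps_power_Suc_Suc\<close>.
\<close>

lemma has_density_catalan_power: "has_density (catalan_fps ^ k) (real k * 2 ^ k / 2)"
proof (induction k rule: induct_nat_012)
  case 0
  have "eventually (\<lambda>n. fps_nth (1 :: real fps) n / real (num_trees n) = 0) sequentially"
    using eventually_gt_at_top[of 0] by eventually_elim auto
  then show ?case by (simp add: has_density_def tendsto_eventually)
next
  case 1
  show ?case by (simp add: has_density_def)
next
  case (ge2 k)
  have "has_density (catalan_fps ^ Suc k - catalan_fps ^ k)
      (real (Suc k) * 2 ^ Suc k / 2 - real k * 2 ^ k / 2)"
    by (rule has_density_diff[OF ge2(2) ge2(1)])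
  also have "real (Suc k) * 2 ^ Suc k / 2 - real k * 2 ^ k / 2 =
      (real (Suc (Suc k)) * 2 ^ Suc (Suc k) / 2) / 4"
    by (simp add: field_simps)
  finally show ?case
    by (simp only: catalan_fps_power_Suc_Suc[symmetric] has_density_X_mult_iff)
qed

section \<open>Trees with a marked leaf\<close>

text \<open>
  In the bivariate series of this section the outer variable marks the index of the leaf and the
  inner one the size of the tree, so that fixing the index leaves a series in the size.
\<close>

definition trees_with_leaf_fps :: "nat \<Rightarrow> real fps fps" where
  "trees_with_leaf_fps d = Abs_fps (\<lambda>r. Abs_fps (\<lambda>n. real (num_trees_with_leaf r d n)))"

text \<open>The root together with its right subtree, when the marked leaf is in the left one.\<close>

definition left_step_fps :: "real fps fps" where
  "left_step_fps = fps_const (fps_X * catalan_fps)"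

text \<open>
  The root together with its left subtree, when the marked leaf is in the right one: a left
  subtree of size \<open>i\<close> adds \<open>i + 1\<close> both to the size and to the index. With \<open>x\<close> for the
  index and \<open>z\<close> for the size, this is \<open>x z C(x z)\<close>.
\<close>

definition right_step_fps :: "real fps fps" where
  "right_step_fps = Abs_fps (\<lambda>i. fps_const (fps_nth (fps_X * catalan_fps) i) * fps_X ^ i)"

lemma right_step_fps_nth:
  "fps_nth right_step_fps i = fps_const (fps_nth (fps_X * catalan_fps) i) * fps_X ^ i"
  by (simp add: right_step_fps_def)

lemma trees_with_leaf_fps_Suc:
  "trees_with_leaf_fps (Suc d) = (left_step_fps + right_step_fps) * trees_with_leaf_fps d"
proof (intro fps_ext)
  fix r n
  let ?G = "\<lambda>r. Abs_fps (\<lambda>n. real (num_trees_with_leaf r d n))"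
  have left: "fps_nth (left_step_fps * trees_with_leaf_fps d) r = fps_X * (?G r * catalan_fps)"
    by (simp add: left_step_fps_def trees_with_leaf_fps_def mult_ac)
  have right: "fps_nth (right_step_fps * trees_with_leaf_fps d) r =
      (\<Sum>i<r. fps_X ^ Suc i * (fps_const (real (num_trees i)) * ?G (r - Suc i)))"
    by (cases r)
      (simp_all add: right_step_fps_nth trees_with_leaf_fps_def fps_mult_nth[of right_step_fps]
        sum.atMost_Suc_shift atLeast0AtMost lessThan_Suc_atMost mult_ac
        del: power_Suc sum.atMost_Suc)
  show "fps_nth (fps_nth (trees_with_leaf_fps (Suc d)) r) n =
      fps_nth (fps_nth ((left_step_fps + right_step_fps) * trees_with_leaf_fps d) r) n"
  proof (cases n)
    case 0
    then show ?thesis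
      unfolding distrib_right fps_add_nth left right
      by (simp add: trees_with_leaf_fps_def num_trees_with_leaf_size_0 fps_sum_nth)
  next
    case (Suc m)
    have "fps_nth (\<Sum>i<r. fps_X ^ Suc i * (fps_const (real (num_trees i)) * ?G (r - Suc i))) n =
        (\<Sum>i<r. if i \<le> m then real (num_trees i * num_trees_with_leaf (r - Suc i) d (m - i)) else 0)"
      unfolding fps_sum_nth
      by (intro sum.cong) (auto simp: Suc fps_X_power_mult_nth simp del: power_Suc)
    also have "\<dots> = (\<Sum>i\<in>{..<r} \<inter> {..m}. real (num_trees i * num_trees_with_leaf (r - Suc i) d (m - i)))"
      by (subst sum.inter_restrict) auto
    also have "{..<r} \<inter> {..m} = {..m} \<inter> {..<r}" by auto
    also have "(\<Sum>i\<in>{..m} \<inter> {..<r}. real (num_trees i * num_trees_with_leaf (r - Suc i) d (m - i))) =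
        (\<Sum>i\<le>m. if i < r then real (num_trees i * num_trees_with_leaf (r - Suc i) d (m - i)) else 0)"
      by (subst sum.inter_restrict) auto
    also have "\<dots> = real (\<Sum>i\<le>m. if i < r then num_trees i * num_trees_with_leaf (r - Suc i) d (m - i) else 0)"
      unfolding of_nat_sum by (intro sum.cong) auto
    finally have "fps_nth (fps_nth (right_step_fps * trees_with_leaf_fps d) r) n = \<dots>"
      by (simp only: right)
    moreover have "fps_nth (fps_nth (left_step_fps * trees_with_leaf_fps d) r) n =
        real (\<Sum>i\<le>m. num_trees_with_leaf r d i * num_trees (m - i))"
      unfolding left by (simp add: Suc fps_mult_nth[of _ catalan_fps] atLeast0AtMost)
    ultimately show ?thesis
      unfolding distrib_right fps_add_nth
      by (simp only: Suc trees_with_leaf_fps_def fps_nth_Abs_fps num_trees_with_leaf_Suc of_nat_add)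
  qed
qed

lemma trees_with_leaf_fps_eq_power:
  "trees_with_leaf_fps d = (left_step_fps + right_step_fps) ^ d"
proof (induction d)
  case 0
  show ?case
    by (intro fps_ext) (auto simp: trees_with_leaf_fps_def num_trees_with_leaf_depth_0)
next
  case (Suc d)
  then show ?case by (simp add: trees_with_leaf_fps_Suc)
qed

lemma right_step_fps_power_nth:
  "fps_nth (right_step_fps ^ j) r = fps_const (fps_nth ((fps_X * catalan_fps) ^ j) r) * fps_X ^ r"
proof (induction j arbitrary: r)
  case (Suc j)
  let ?B = "fps_X * catalan_fps"
  have "fps_nth (right_step_fps ^ Suc j) r =
      (\<Sum>i=0..r. (fps_const (fps_nth ?B i) * fps_X ^ i) *
        (fps_const (fps_nth (?B ^ j) (r - i)) * fps_X ^ (r - i)))"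
    by (simp only: power_Suc fps_mult_nth[of right_step_fps] Suc right_step_fps_nth)
  also have "\<dots> = (\<Sum>i=0..r. fps_const (fps_nth ?B i * fps_nth (?B ^ j) (r - i)) * fps_X ^ r)"
  proof (intro sum.cong refl)
    fix i assume "i \<in> {0..r}"
    then have "(fps_X :: real fps) ^ r = fps_X ^ i * fps_X ^ (r - i)"
      by (simp flip: power_add)
    then show "(fps_const (fps_nth ?B i) * fps_X ^ i) *
        (fps_const (fps_nth (?B ^ j) (r - i)) * fps_X ^ (r - i)) =
        fps_const (fps_nth ?B i * fps_nth (?B ^ j) (r - i)) * fps_X ^ r"
      by (simp only: fps_const_mult[symmetric] mult_ac)
  qed
  also have "\<dots> = fps_const (fps_nth (?B ^ Suc j) r) * fps_X ^ r"
  proof -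
    have "(\<Sum>i=0..r. fps_const (fps_nth ?B i * fps_nth (?B ^ j) (r - i))) =
        fps_const (fps_nth (?B ^ Suc j) r)"
      by (rule fps_ext) (simp add: fps_sum_nth fps_mult_nth[of ?B])
    then show ?thesis by (simp only: sum_distrib_right[symmetric])
  qed
  finally show ?case .
qed auto

text \<open>In the summand \<open>j\<close> of the binomial expansion, the path turns right exactly \<open>j\<close> times.\<close>

lemma trees_with_leaf_fps_expand:
  "fps_nth (trees_with_leaf_fps d) r =
    (\<Sum>j\<le>d. fps_const (real (d choose j) * fps_nth ((fps_X * catalan_fps) ^ j) r) *
      (fps_X ^ (r + (d - j)) * catalan_fps ^ (d - j)))"
proof -
  have "trees_with_leaf_fps d =
      (\<Sum>j\<le>d. of_nat (d choose j) * right_step_fps ^ j * left_step_fps ^ (d - j))"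
    unfolding trees_with_leaf_fps_eq_power
    by (subst add.commute) (rule binomial_ring)
  also have "\<dots> = (\<Sum>j\<le>d. right_step_fps ^ j *
      fps_const (fps_const (real (d choose j)) * (fps_X * catalan_fps) ^ (d - j)))"
    by (simp add: left_step_fps_def fps_const_power mult_ac flip: fps_of_nat)
  finally have "fps_nth (trees_with_leaf_fps d) r =
      (\<Sum>j\<le>d. fps_const (fps_nth ((fps_X * catalan_fps) ^ j) r) * fps_X ^ r *
        (fps_const (real (d choose j)) * (fps_X * catalan_fps) ^ (d - j)))"
    by (simp only: fps_sum_nth fps_mult_right_const_nth right_step_fps_power_nth)
  also have "\<dots> =
      (\<Sum>j\<le>d. fps_const (real (d choose j) * fps_nth ((fps_X * catalan_fps) ^ j) r) *
        (fps_X ^ (r + (d - j)) * catalan_fps ^ (d - j)))"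
    by (simp only: fps_const_mult[symmetric] power_add power_mult_distrib[of fps_X _ "d - _"] mult_ac)
  finally show ?thesis .
qed

section \<open>The limit distribution\<close>

text \<open>The series \<open>(x/4) C(x/4)\<close>.\<close>

definition scaled_catalan_fps :: "real fps" where
  "scaled_catalan_fps = (fps_X * catalan_fps) oo (fps_const (1/4) * fps_X)"

lemma scaled_catalan_fps_power_nth:
  "fps_nth (scaled_catalan_fps ^ j) r = fps_nth ((fps_X * catalan_fps) ^ j) r / 4 ^ r"
  unfolding scaled_catalan_fps_def
  by (subst fps_compose_power) (simp_all add: fps_compose_linear power_divide)

lemma scaled_catalan_fps_eq:
  "scaled_catalan_fps = fps_const (1/2) * (1 - fps_radical root 2 (1 - fps_X))"
proof -
  let ?c = "fps_const (1/4) * fps_X :: real fps"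
  define s :: "real fps" where "s = fps_radical root 2 (1 - fps_X)"
  have B: "fps_X * catalan_fps = fps_X + (fps_X * catalan_fps) ^ 2"
  proof -
    have "fps_X * catalan_fps = fps_X * (1 + fps_X * catalan_fps ^ 2)"
      using catalan_fps_quadratic by simp
    also have "\<dots> = fps_X + (fps_X * catalan_fps) ^ 2"
      by (simp add: power2_eq_square algebra_simps)
    finally show ?thesis .
  qed
  have "scaled_catalan_fps = (fps_X + (fps_X * catalan_fps) ^ 2) oo ?c"
    unfolding scaled_catalan_fps_def using B by simp
  also have "\<dots> = ?c + scaled_catalan_fps ^ 2"
    unfolding scaled_catalan_fps_def fps_compose_add_distrib
    by (subst fps_compose_power) (simp_all add: fps_X_fps_compose_startby0)
  finally have W: "scaled_catalan_fps - scaled_catalan_fps ^ 2 = ?c"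
    by (simp add: algebra_simps)
  have "(1 - 2 * scaled_catalan_fps) ^ 2 =
      1 - 4 * (scaled_catalan_fps - scaled_catalan_fps ^ 2)"
    by (simp add: power2_eq_square algebra_simps)
  also have "\<dots> = 1 - fps_X"
    unfolding W by (simp add: numeral_fps_const flip: mult.assoc)
  also have "\<dots> = s ^ 2"
    unfolding s_def
    using power_radical[of "1 - fps_X :: real fps" root 1] by (simp add: numeral_2_eq_2)
  finally have "1 - 2 * scaled_catalan_fps = s \<or> 1 - 2 * scaled_catalan_fps = - s"
    by (simp add: power2_eq_iff)
  \<comment> \<open>Both square roots have a constant coefficient equal to \<open>1\<close>, which excludes \<open>- s\<close>.\<close>
  moreover have "fps_nth (1 - 2 * scaled_catalan_fps) 0 \<noteq> fps_nth (- s) 0"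
    by (simp add: scaled_catalan_fps_def s_def numeral_fps_const)
  ultimately have s_eq: "s = 1 - 2 * scaled_catalan_fps" by metis
  have "fps_const (1/2) * (1 - s) = fps_const (1/2) * (2 * scaled_catalan_fps)"
    unfolding s_eq by simp
  also have "\<dots> = scaled_catalan_fps"
    by (simp add: numeral_fps_const flip: mult.assoc)
  finally show ?thesis by (simp add: s_def)
qed

definition limit_fps :: "nat \<Rightarrow> real fps" where
  "limit_fps d = fps_const (real d / 4) * (fps_const (1/2) + scaled_catalan_fps) ^ (d - 1)"

text \<open>
  By absorption \<open>(d - j) (d choose j) = d (d - 1 choose j)\<close>, the weighted sum over the number of
  right turns is again a binomial expansion, of one degree less.
\<close>

lemma limit_fps_nth:
  "fps_nth (limit_fps d) r =
    (\<Sum>j\<le>d. (real (d choose j) * fps_nth ((fps_X * catalan_fps) ^ j) r) *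
      ((real (d - j) * 2 ^ (d - j) / 2) / 4 ^ (r + (d - j))))"
proof (cases d)
  case 0
  then show ?thesis by (simp add: limit_fps_def)
next
  case (Suc e)
  let ?w = "\<lambda>j. fps_nth (scaled_catalan_fps ^ j) r"
  let ?b = "\<lambda>j. fps_nth ((fps_X * catalan_fps) ^ j) r"
  let ?t = "\<lambda>j. (real (d choose j) * ?b j) * ((real (d - j) * 2 ^ (d - j) / 2) / 4 ^ (r + (d - j)))"
  have "limit_fps d = fps_const (real d / 4) *
      (\<Sum>j\<le>e. fps_const (real (e choose j) * (1/2) ^ (e - j)) * scaled_catalan_fps ^ j)"
    unfolding limit_fps_def
    by (subst add.commute, subst binomial_ring)
      (simp add: Suc fps_const_power fps_const_mult[symmetric] mult_ac
        del: fps_const_mult flip: fps_of_nat)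
  then have "fps_nth (limit_fps d) r =
      (\<Sum>j\<le>e. real d / 4 * (real (e choose j) * (1/2) ^ (e - j) * ?w j))"
    by (simp add: fps_sum_nth sum_distrib_left)
  also have "\<dots> = (\<Sum>j\<le>e. ?t j)"
  proof (intro sum.cong refl)
    fix j assume "j \<in> {..e}"
    then have j: "d - j = Suc (e - j)" using Suc by auto
    have "(d - j) * (d choose j) = d * (e choose j)"
      using binomial_absorb_comp[of d j] Suc by simp
    then have absorb: "real (d - j) * real (d choose j) = real d * real (e choose j)"
      by (metis of_nat_mult)
    have four: "(4 :: real) ^ m = 2 ^ m * 2 ^ m" for m
      by (simp flip: power_mult_distrib)
    have "?t j = (real (d - j) * real (d choose j)) * (?b j / 4 ^ r) *
        (2 ^ Suc (e - j) / 2 / 4 ^ Suc (e - j))"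
      unfolding power_add j[symmetric] by (simp add: field_simps)
    also have "\<dots> = (real d * real (e choose j)) * ?w j * ((1/2) ^ (e - j) / 4)"
      unfolding absorb scaled_catalan_fps_power_nth four
      by (simp add: field_simps power_divide)
    finally show "real d / 4 * (real (e choose j) * (1/2) ^ (e - j) * ?w j) = ?t j"
      by simp
  qed
  also have "\<dots> = (\<Sum>j\<le>d. ?t j)"
    by (simp add: Suc)
  finally show ?thesis .
qed

lemma depth_prob_tendsto: "depth_prob r d \<longlonglongrightarrow> fps_nth (limit_fps d) r"
proof -
  have "has_density (fps_nth (trees_with_leaf_fps d) r) (fps_nth (limit_fps d) r)"
    unfolding trees_with_leaf_fps_expand limit_fps_nth
    by (intro has_density_sum has_density_cmult has_density_X_power_mult has_density_catalan_power)
  then have "(\<lambda>n. real (num_trees_with_leaf r d n) / real (num_trees n)) \<longlonglongrightarrow> fps_nth (limit_fps d) r"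
    by (simp add: has_density_def trees_with_leaf_fps_def)
  then show ?thesis by (simp add: depth_prob_eq[abs_def])
qed

section \<open>Summation over the depths\<close>

lemma fps_geometric_deriv:
  fixes u :: "'a :: comm_ring_1"
  shows "Abs_fps (\<lambda>d. of_nat d * u ^ (d - 1)) * (1 - fps_const u * fps_X) ^ 2 = fps_X"
proof -
  let ?S = "Abs_fps (\<lambda>d. u ^ d)" and ?T = "Abs_fps (\<lambda>d. of_nat d * u ^ (d - 1))"
  have S: "?S * (1 - fps_const u * fps_X) = 1"
  proof (rule fps_ext)
    fix n show "fps_nth (?S * (1 - fps_const u * fps_X)) n = fps_nth 1 n"
      by (cases n) (simp_all add: right_diff_distrib mult.left_commute[of ?S])
  qed
  have T: "?T * (1 - fps_const u * fps_X) = fps_X * ?S"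
  proof (rule fps_ext)
    fix n
    have *: "u * (of_nat m * u ^ (m - Suc 0)) = of_nat m * u ^ m" for m
      by (cases m) (simp_all add: mult_ac)
    show "fps_nth (?T * (1 - fps_const u * fps_X)) n = fps_nth (fps_X * ?S) n"
      by (cases n) (simp_all add: right_diff_distrib mult.left_commute[of ?T] * algebra_simps)
  qed
  have "?T * (1 - fps_const u * fps_X) ^ 2 =
      fps_X * (?S * (1 - fps_const u * fps_X))"
    by (simp only: power2_eq_square mult.assoc[symmetric] T)
  then show ?thesis by (simp add: S)
qed

text \<open>
  The coefficients are themselves power series and do not form a field, so the divisor must have
  an invertible constant coefficient for the division to be the expected one.
\<close>

lemma fps_divide_eqI:
  fixes f g q :: "'a :: field fps fps"
  assumes "q * g = f" and "fps_nth (fps_nth g 0) 0 \<noteq> 0"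
  shows "f / g = q"
proof -
  have "fps_nth g 0 * inverse (fps_nth g 0) = 1"
    using assms(2) by (simp add: inverse_mult_eq_1')
  then have "g * inverse g = 1"
    unfolding fps_inverse_def by (rule fps_right_inverse)
  moreover have "fps_nth g 0 \<noteq> 0" using assms(2) by auto
  then have "f / g = f * inverse g" by (rule fps_divide_unit)
  ultimately show ?thesis by (simp add: assms(1)[symmetric] mult.assoc)
qed

lemma sum_limit_fps:
  "fps_y / (2 - 2 * fps_y + fps_y * sqrt_one_minus_x) ^ 2 = Abs_fps limit_fps"
proof (rule fps_divide_eqI)
  let ?U = "fps_const (1/2) + scaled_catalan_fps"
  let ?D = "2 - 2 * fps_y + fps_y * sqrt_one_minus_x"
  have sqrt: "sqrt_one_minus_x = 2 - 2 * fps_const ?U"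
  proof -
    have "2 * scaled_catalan_fps = 1 - fps_radical root 2 (1 - fps_X)"
      unfolding scaled_catalan_fps_eq by (simp add: numeral_fps_const flip: mult.assoc)
    moreover have "2 * fps_const (1/2) = (1 :: real fps)"
      by (simp add: numeral_fps_const)
    ultimately have "fps_radical root 2 (1 - fps_X) = 2 - 2 * ?U"
      by (simp only: distrib_left) (simp add: algebra_simps)
    then show ?thesis
      unfolding sqrt_one_minus_x_def by (simp add: numeral_fps_const)
  qed
  have D: "?D = 2 * (1 - fps_const ?U * fps_X)"
    unfolding sqrt fps_y_def by (simp add: algebra_simps)
  have L: "Abs_fps limit_fps * 4 = Abs_fps (\<lambda>d. of_nat d * ?U ^ (d - 1))"
  proof -
    have "limit_fps d * 4 = of_nat d * ?U ^ (d - 1)" for d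
      by (simp add: limit_fps_def numeral_fps_const mult_ac flip: fps_of_nat mult.assoc)
    then show ?thesis
      by (simp add: fps_eq_iff numeral_fps_const)
  qed
  have "Abs_fps limit_fps * ?D ^ 2 = (Abs_fps limit_fps * 4) * (1 - fps_const ?U * fps_X) ^ 2"
  proof -
    have "(2 :: real fps fps) ^ 2 = 4" by simp
    then show ?thesis unfolding D by (simp only: power_mult_distrib mult.assoc)
  qed
  also have "\<dots> = fps_y"
    unfolding L fps_y_def by (rule fps_geometric_deriv)
  finally show "Abs_fps limit_fps * ?D ^ 2 = fps_y" .
  show "fps_nth (fps_nth (?D ^ 2) 0) 0 \<noteq> 0"
    by (simp add: fps_y_def power2_eq_square numeral_fps_const)
qed

theorem theorem2p3:
  shows "(\<forall>r d. d \<ge> 1 \<longrightarrow> convergent (depth_prob r d)) \<and>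
    bivariate_fps (\<lambda>r d. if d \<ge> 1 then lim (depth_prob r d) else 0) =
      fps_y / (2 - 2 * fps_y + fps_y * sqrt_one_minus_x) ^ 2"
proof
  show "\<forall>r d. d \<ge> 1 \<longrightarrow> convergent (depth_prob r d)"
    using depth_prob_tendsto by (blast intro: convergentI)
  have "lim (depth_prob r d) = fps_nth (limit_fps d) r" for r d
    by (rule limI) (rule depth_prob_tendsto)
  moreover have "fps_nth (limit_fps 0) r = 0" for r
    by (simp add: limit_fps_def)
  ultimately have "(if d \<ge> 1 then lim (depth_prob r d) else 0) = fps_nth (limit_fps d) r" for r d
    by (cases d) simp_all
  then have "bivariate_fps (\<lambda>r d. if d \<ge> 1 then lim (depth_prob r d) else 0) = Abs_fps limit_fps"
    by (simp add: bivariate_fps_def fps_eq_iff)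
  then show "bivariate_fps (\<lambda>r d. if d \<ge> 1 then lim (depth_prob r d) else 0) =
      fps_y / (2 - 2 * fps_y + fps_y * sqrt_one_minus_x) ^ 2"
    by (simp add: sum_limit_fps)
qed

end
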